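(* Let $f_1,f_2\in C^2(\mathbb{R})$ satisfy, for $i=1,2$, $f_i''(t)>0$ for all $t\in\mathbb{R}$ and $f_i'\in L^\infty(\mathbb{R})$. Let $f(p_1,p_2):=f_1(p_1)+f_2(p_2)$ for $(p_1,p_2)\in\mathbb{R}^2$, and let $u\in C^2(\mathbb{R}^2)$ be an entire solution of $\operatorname{div}(Df(\nabla u))=0$, i.e. $$f_1''(\partial_1u)\,\partial_{11}u+f_2''(\partial_2u)\,\partial_{22}u=0\quad\text{on } \mathbb{R}^2 .$$ Define $$\Theta:=\frac{f_2''(\partial_2u)}{f_1''(\partial_1u)}\quad\text{on } \mathbb{R}^2 .$$ If $\Theta\in L^\infty(\mathbb{R}^2)$ or $\frac1\Theta\in L^\infty(\mathbb{R}^2)$, then $u$ is an affine function. *)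

theory Defs
  imports "HOL-Analysis.Analysis"
begin

primrec C_k_real :: "nat \<Rightarrow> (real \<Rightarrow> real) \<Rightarrow> bool" where
  "C_k_real 0 f \<longleftrightarrow> continuous_on UNIV f"
| "C_k_real (Suc k) f \<longleftrightarrow> continuous_on UNIV f \<and>
     (\<forall>t. f field_differentiable at t) \<and> C_k_real k (deriv f)"

definition partially_differentiable :: "'n::finite \<Rightarrow> (real^'n \<Rightarrow> real) \<Rightarrow> real^'n \<Rightarrow> bool" where
  "partially_differentiable i g x \<longleftrightarrow>
     (\<lambda>t. g (x + t *\<^sub>R axis i 1)) field_differentiable at 0"

definition partial_deriv :: "'n::finite \<Rightarrow> (real^'n \<Rightarrow> real) \<Rightarrow> real^'n \<Rightarrow> real" where
  "partial_deriv i g x = deriv (\<lambda>t. g (x + t *\<^sub>R axis i 1)) 0"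

primrec C_k :: "nat \<Rightarrow> (real^'n::finite \<Rightarrow> real) \<Rightarrow> bool" where
  "C_k 0 g \<longleftrightarrow> continuous_on UNIV g"
| "C_k (Suc k) g \<longleftrightarrow> continuous_on UNIV g \<and>
     (\<forall>i. (\<forall>x. partially_differentiable i g x) \<and> C_k k (partial_deriv i g))"

definition gradient :: "(real^'n::finite \<Rightarrow> real) \<Rightarrow> real^'n \<Rightarrow> real^'n" where
  "gradient g x = (\<chi> i. partial_deriv i g x)"

definition divergence :: "(real^'n::finite \<Rightarrow> real^'n) \<Rightarrow> real^'n \<Rightarrow> real" where
  "divergence F x = (\<Sum>i\<in>UNIV. partial_deriv i (\<lambda>y. F y $ i) x)"

definition L_infinity :: "('a::euclidean_space \<Rightarrow> real) \<Rightarrow> bool" where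
  "L_infinity g \<longleftrightarrow> g \<in> borel_measurable lebesgue \<and>
     (\<exists>C. AE x in lebesgue. \<bar>g x\<bar> \<le> C)"

text \<open>The divergence form and the non-divergence form of the equation agree in this setting.\<close>

lemma gradient_separated:
  fixes f1 f2 :: "real \<Rightarrow> real" and p :: "real^2"
  assumes "f1 field_differentiable at (p $ 1)" "f2 field_differentiable at (p $ 2)"
  shows "gradient (\<lambda>p::real^2. f1 (p $ 1) + f2 (p $ 2)) p $ 1 = deriv f1 (p $ 1)"
    and "gradient (\<lambda>p::real^2. f1 (p $ 1) + f2 (p $ 2)) p $ 2 = deriv f2 (p $ 2)"
proof -
  have d: "DERIV f1 (p $ 1) :> deriv f1 (p $ 1)" "DERIV f2 (p $ 2) :> deriv f2 (p $ 2)"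
    using assms by (simp_all add: DERIV_deriv_iff_field_differentiable)
  have "((\<lambda>t. f1 (p $ 1 + t) + f2 (p $ 2)) has_field_derivative deriv f1 (p $ 1)) (at 0)"
    using d by (auto intro!: derivative_eq_intros DERIV_chain2[where f = f1])
  then show "gradient (\<lambda>p::real^2. f1 (p $ 1) + f2 (p $ 2)) p $ 1 = deriv f1 (p $ 1)"
    by (simp add: gradient_def partial_deriv_def axis_def DERIV_imp_deriv)
  have "((\<lambda>t. f1 (p $ 1) + f2 (p $ 2 + t)) has_field_derivative deriv f2 (p $ 2)) (at 0)"
    using d by (auto intro!: derivative_eq_intros DERIV_chain2[where f = f2])
  then show "gradient (\<lambda>p::real^2. f1 (p $ 1) + f2 (p $ 2)) p $ 2 = deriv f2 (p $ 2)"
    by (simp add: gradient_def partial_deriv_def axis_def DERIV_imp_deriv)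
qed

lemma partial_deriv_chain:
  assumes "h field_differentiable at (g x)" "partially_differentiable i g x"
  shows "partial_deriv i (\<lambda>y. h (g y)) x = deriv h (g x) * partial_deriv i g x"
proof -
  have "DERIV (\<lambda>t. g (x + t *\<^sub>R axis i 1)) 0 :> partial_deriv i g x"
    using assms(2)
    by (simp add: partially_differentiable_def partial_deriv_def DERIV_deriv_iff_field_differentiable)
  moreover have "DERIV h (g (x + 0 *\<^sub>R axis i 1)) :> deriv h (g x)"
    using assms(1) by (simp add: DERIV_deriv_iff_field_differentiable)
  ultimately have "DERIV (\<lambda>t. h (g (x + t *\<^sub>R axis i 1))) 0 :> deriv h (g x) * partial_deriv i g x"
    by (rule DERIV_chain2[rotated])
  then show ?thesis
    unfolding partial_deriv_def[of i "\<lambda>y. h (g y)"] by (rule DERIV_imp_deriv)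
qed

lemma divergence_form_iff:
  fixes f1 f2 :: "real \<Rightarrow> real" and u :: "real^2 \<Rightarrow> real"
  assumes "C_k_real 2 f1" "C_k_real 2 f2" "C_k 2 u"
  shows "divergence (\<lambda>y. gradient (\<lambda>p::real^2. f1 (p $ 1) + f2 (p $ 2)) (gradient u y)) x =
    deriv (deriv f1) (partial_deriv 1 u x) * partial_deriv 1 (partial_deriv 1 u) x +
    deriv (deriv f2) (partial_deriv 2 u x) * partial_deriv 2 (partial_deriv 2 u) x"
proof -
  have f: "f1 field_differentiable at t" "f2 field_differentiable at t"
    "deriv f1 field_differentiable at t" "deriv f2 field_differentiable at t" for t
    using assms(1,2) by (simp_all add: numeral_2_eq_2)
  have u: "partially_differentiable i (partial_deriv j u) y" for i j y
    using assms(3) by (simp add: numeral_2_eq_2)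
  have g: "gradient u y $ i = partial_deriv i u y" for i y
    by (simp add: gradient_def)
  show ?thesis
    by (simp add: divergence_def sum_2 gradient_separated f g partial_deriv_chain u)
qed

end

theory Submission
  imports Defs
begin

text \<open>
  Put \<open>w = f\<^sub>1'(\<partial>\<^sub>1u)\<close> and \<open>v = f\<^sub>2'(\<partial>\<^sub>2u)\<close>. The equation says \<open>\<partial>\<^sub>1w = -\<partial>\<^sub>2v\<close>, and the symmetry of the
  Hessian says \<open>\<partial>\<^sub>1v = \<Theta> \<partial>\<^sub>2w\<close>. Hence \<open>w\<close> is a bounded weak solution of
  \<open>\<partial>\<^sub>1\<partial>\<^sub>1w + \<partial>\<^sub>2(\<Theta> \<partial>\<^sub>2w) = 0\<close> on the plane. If \<open>\<Theta>\<close> is bounded, testing with \<open>\<eta>\<^sup>2w\<close> gives a Caccioppoli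
  inequality for the energy \<open>(\<partial>\<^sub>1w)\<^sup>2 + \<Theta> (\<partial>\<^sub>2w)\<^sup>2\<close>, which needs no lower bound on \<open>\<Theta>\<close>: the total energy is
  finite, and then hole filling shows that it vanishes. So \<open>\<nabla>w = 0\<close>, and with it the whole
  Hessian of \<open>u\<close>. If \<open>1/\<Theta>\<close> is bounded, exchange the two coordinates.
\<close>

section \<open>Continuously differentiable functions on the plane
  \<open>real \<times> real\<close>\<close>

definition C1_partials ::
  "(real \<times> real \<Rightarrow> real) \<Rightarrow> (real \<times> real \<Rightarrow> real) \<Rightarrow> (real \<times> real \<Rightarrow> real) \<Rightarrow> bool" where
  "C1_partials p px py \<longleftrightarrow>
     continuous_on UNIV p \<and> continuous_on UNIV px \<and> continuous_on UNIV py \<and>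
     (\<forall>x y. ((\<lambda>t. p (t, y)) has_real_derivative px (x, y)) (at x)) \<and>
     (\<forall>x y. ((\<lambda>t. p (x, t)) has_real_derivative py (x, y)) (at y))"

lemma C1_partialsD:
  assumes "C1_partials p px py"
  shows "continuous_on UNIV p" "continuous_on UNIV px" "continuous_on UNIV py"
    and "((\<lambda>t. p (t, y)) has_real_derivative px (x, y)) (at x)"
    and "((\<lambda>t. p (x, t)) has_real_derivative py (x, y)) (at y)"
  using assms by (auto simp: C1_partials_def)

lemma C1_partials_mult:
  assumes "C1_partials p px py" "C1_partials q qx qy"
  shows "C1_partials (\<lambda>z. p z * q z) (\<lambda>z. px z * q z + p z * qx z) (\<lambda>z. py z * q z + p z * qy z)"
  using assms unfolding C1_partials_def
  by (auto intro!: continuous_intros derivative_eq_intros)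

lemma C1_partials_shift:
  assumes "C1_partials p px py"
  shows "C1_partials (\<lambda>z. p (z + c)) (\<lambda>z. px (z + c)) (\<lambda>z. py (z + c))"
proof -
  obtain a b where c: "c = (a, b)" by force
  have "((\<lambda>t. p (t + a, y + b)) has_real_derivative px (x + a, y + b)) (at x)" for x y
    using C1_partialsD(4)[OF assms, of "y + b" "x + a"] by (simp add: DERIV_shift)
  moreover have "((\<lambda>t. p (x + a, t + b)) has_real_derivative py (x + a, y + b)) (at y)" for x y
    using C1_partialsD(5)[OF assms, of "x + a" "y + b"] by (simp add: DERIV_shift)
  ultimately show ?thesis
    using C1_partialsD(1-3)[OF assms] unfolding C1_partials_def c
    by (auto intro!: continuous_on_compose2[of UNIV _ UNIV "\<lambda>z. z + (a, b)"] continuous_intros)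
qed

section \<open>Integration by parts on squares\<close>

lemma integral_partial_derivative_eq_0:
  fixes q qy :: "real \<times> real \<Rightarrow> real"
  assumes "continuous_on UNIV qy"
    and "\<And>x y. ((\<lambda>t. q (x, t)) has_real_derivative qy (x, y)) (at y)"
    and "\<And>x. q (x, c) = 0" "\<And>x. q (x, d) = 0" and "c \<le> d"
  shows "integral (cbox (a, c) (b, d)) qy = 0"
proof -
  have "integral {c..d} (\<lambda>y. qy (x, y)) = 0" for x
  proof -
    have "((\<lambda>y. qy (x, y)) has_integral q (x, d) - q (x, c)) {c..d}"
      using assms(2,5)
      by (intro fundamental_theorem_of_calculus)
        (auto simp: has_real_derivative_iff_has_vector_derivative[symmetric]
          intro: has_field_derivative_at_within)
    then show ?thesis using assms(3,4) by (simp add: integral_unique)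
  qed
  then have "integral (cbox a b) (\<lambda>x. integral (cbox c d) (\<lambda>y. qy (x, y))) = 0"
    by simp
  moreover have "continuous_on (cbox (a, c) (b, d)) qy"
    using assms(1) continuous_on_subset by blast
  ultimately show ?thesis
    by (metis integral_prod_continuous)
qed

text \<open>Both the box and its translate by \<open>s\<close> contain the box
  \<open>cbox c d\<close> outside which \<open>F\<close> vanishes, so each integral equals the one
  over \<open>cbox c d\<close>.\<close>

lemma integral_shift_compact_support:
  fixes F :: "'a::euclidean_space \<Rightarrow> real"
  assumes "continuous_on UNIV F" and F0: "\<And>z. z \<notin> cbox c d \<Longrightarrow> F z = 0"
    and "cbox c d \<subseteq> cbox a b" "cbox c d \<subseteq> cbox (a + s) (b + s)"
  shows "integral (cbox a b) (\<lambda>z. F (z + s)) = integral (cbox a b) F"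
proof -
  have "F integrable_on cbox c d"
    using assms(1) continuous_on_subset integrable_continuous by blast
  then have i: "(F has_integral integral (cbox c d) F) (cbox c d)"
    by blast
  have "integral (cbox (a + s) (b + s)) F = integral (cbox c d) F"
    "integral (cbox a b) F = integral (cbox c d) F"
    by (auto intro!: integral_unique has_integral_on_superset[OF i] F0 assms(3,4))
  then show ?thesis
    using integral_shift_cbox_plus[of a b F s] by (simp add: o_def add.commute)
qed

text \<open>Differentiation under the integral sign. Translating the argument of \<open>v\<close>
  produces \<open>vx\<close> under the integral while asking only for continuity of the factor
  \<open>k\<close>, which may therefore itself be a first partial derivative.\<close>

lemma leibniz_shift_first:
  assumes v: "C1_partials v vx vy" and k: "continuous_on UNIV k"
  shows "((\<lambda>h. integral (cbox a b) (\<lambda>z. k z * v (z + (h, 0)))) has_real_derivative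
    integral (cbox a b) (\<lambda>z. k z * vx z)) (at 0)"
proof -
  have "((\<lambda>h. integral (cbox a b) (\<lambda>z. k z * v (z + (h, 0)))) has_real_derivative
    integral (cbox a b) (\<lambda>z. k z * vx (z + (0, 0)))) (at 0 within UNIV)"
  proof (rule leibniz_rule_field_derivative[where fx = "\<lambda>h z. k z * vx (z + (h, 0))"])
    fix h z
    show "((\<lambda>h. k z * v (z + (h, 0))) has_real_derivative k z * vx (z + (h, 0))) (at h within UNIV)"
      using C1_partialsD(4)[OF v, of "snd z" "h + fst z"]
      by (auto intro!: derivative_eq_intros simp: DERIV_shift add.commute split: prod.splits
         simp: plus_prod_def)
  next
    fix h
    show "(\<lambda>z. k z * v (z + (h, 0))) integrable_on cbox a b"
      by (intro integrable_continuous continuous_intros continuous_on_subset[OF k]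
           continuous_on_compose2[OF C1_partialsD(1)[OF v]]) auto
  next
    show "continuous_on (UNIV \<times> cbox a b) (\<lambda>(h, z). k z * vx (z + (h, 0)))"
      unfolding split_beta
      by (intro continuous_intros continuous_on_compose2[OF k] continuous_on_compose2[OF C1_partialsD(2)[OF v]]) auto
  qed auto
  then show ?thesis by (simp add: zero_prod_def[symmetric])
qed

text \<open>Stokes for the form \<open>p dv\<close>. As \<open>v\<close> is only \<open>C\<^sup>1\<close>, one cannot integrate by parts twice;
  instead both sides are derivatives at \<open>h = 0\<close> of integrals against translates by \<open>h\<close>.\<close>

lemma integral_partials_swap:
  assumes p: "C1_partials p px py" and v: "C1_partials v vx vy"
    and supp: "\<And>x y. \<not> (\<bar>x\<bar> \<le> m \<and> \<bar>y\<bar> \<le> m) \<Longrightarrow> p (x, y) = 0"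
    and m: "0 \<le> m" "m < M"
  shows "integral (cbox (-M, -M) (M, M)) (\<lambda>z. px z * vy z) =
         integral (cbox (-M, -M) (M, M)) (\<lambda>z. py z * vx z)"
proof -
  let ?Q = "cbox (-M, -M) (M, M)"
  have supp': "p z = 0" if "z \<notin> cbox (-m, -m) (m, m)" for z
  proof -
    obtain x y where z: "z = (x, y)" by force
    then have "\<not> (\<bar>x\<bar> \<le> m \<and> \<bar>y\<bar> \<le> m)"
      using that by (auto simp: cbox_Pair_eq abs_le_iff)
    then show ?thesis using supp z by blast
  qed
  define G where "G h = integral ?Q (\<lambda>z. py z * v (z + (h, 0)))" for h
  define H where "H h = integral ?Q (\<lambda>z. vy z * p (z + (h, 0)))" for h
  have G: "(G has_real_derivative integral ?Q (\<lambda>z. py z * vx z)) (at 0)"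
    unfolding G_def by (rule leibniz_shift_first[OF v C1_partialsD(3)[OF p]])
  have H: "(H has_real_derivative integral ?Q (\<lambda>z. vy z * px z)) (at 0)"
    unfolding H_def by (rule leibniz_shift_first[OF p C1_partialsD(3)[OF v]])
  \<comment> \<open>The product of \<open>p\<close> with the translate of \<open>v\<close> vanishes
    near the boundary, so integrating its derivative in the second variable moves that derivative
    from \<open>p\<close> to \<open>v\<close>. The substitution by \<open>-h\<close> then moves the
    translation from \<open>v\<close> to \<open>p\<close>; the support of \<open>p\<close> stays
    inside the square because \<open>\<bar>h\<bar> < M - m\<close>.\<close>
  have GH: "G h = - H (- h)" if h: "\<bar>h\<bar> < M - m" for h
  proof -
    note C = C1_partials_mult[OF p C1_partials_shift[OF v, of "(h, 0)"]]
    have "integral ?Q (\<lambda>z. py z * v (z + (h, 0)) + p z * vy (z + (h, 0))) = 0"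
      using m by (intro integral_partial_derivative_eq_0[OF C1_partialsD(3)[OF C] C1_partialsD(5)[OF C]])
        (auto simp: supp)
    moreover have "(\<lambda>z. py z * v (z + (h, 0))) integrable_on ?Q"
      "(\<lambda>z. p z * vy (z + (h, 0))) integrable_on ?Q"
      by (intro integrable_continuous continuous_intros
          continuous_on_compose2[OF C1_partialsD(1)[OF v]] continuous_on_compose2[OF C1_partialsD(3)[OF v]]
          continuous_on_subset[OF C1_partialsD(1)[OF p]] continuous_on_subset[OF C1_partialsD(3)[OF p]]; simp)+
    ultimately have "G h = - integral ?Q (\<lambda>z. p z * vy (z + (h, 0)))"
      by (simp add: G_def integral_add)
    also have "integral ?Q (\<lambda>z. p z * vy (z + (h, 0))) = H (- h)"
    proof -
      let ?F = "\<lambda>z. vy z * p (z + (- h, 0))"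
      have "integral ?Q (\<lambda>z. ?F (z + (h, 0))) = integral ?Q ?F"
      proof (rule integral_shift_compact_support[where c = "(-m + h, -m)" and d = "(m + h, m)"])
        show "continuous_on UNIV ?F"
          by (intro continuous_intros C1_partialsD(3)[OF v] continuous_on_compose2[OF C1_partialsD(1)[OF p]]) auto
        show "?F z = 0" if "z \<notin> cbox (-m + h, -m) (m + h, m)" for z
          using that supp'[of "z + (- h, 0)"] by (cases z) (auto simp: cbox_Pair_eq)
      qed (use h m in \<open>auto simp: cbox_Pair_eq\<close>)
      then show ?thesis by (simp add: H_def add.assoc zero_prod_def[symmetric] mult.commute)
    qed
    finally show ?thesis .
  qed
  \<comment> \<open>The two signs cancel: the derivative of \<open>- H (- h)\<close> at 0 is that of
    \<open>H\<close>. Uniqueness of the derivative of \<open>G\<close> at 0 then gives the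
    claim.\<close>
  have "((\<lambda>h. - H (- h)) has_real_derivative integral ?Q (\<lambda>z. vy z * px z)) (at 0)"
    using DERIV_mirror[of H "integral ?Q (\<lambda>z. vy z * px z)" 0] H
    by (auto intro!: derivative_eq_intros DERIV_chain2[where f = H])
  then have "(G has_real_derivative integral ?Q (\<lambda>z. vy z * px z)) (at 0)"
    by (rule has_field_derivative_transform_within[where d = "M - m"]) (use m GH in \<open>auto simp: dist_real_def\<close>)
  then show ?thesis
    using DERIV_unique[OF G] by (simp add: mult.commute)
qed

section \<open>An explicit cutoff function\<close>

text \<open>Squaring the positive part removes the corner at 0, where the difference quotient is
  \<open>max 0 h\<close> and tends to 0. Two such truncations build the cutoff.\<close>

lemma DERIV_max_0_power2: "((\<lambda>s::real. (max 0 s)\<^sup>2) has_real_derivative 2 * max 0 s) (at s)"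
proof -
  consider "s > 0" | "s < 0" | "s = 0" by linarith
  then show ?thesis
  proof cases
    case 1
    have "((\<lambda>s::real. s\<^sup>2) has_real_derivative 2 * max 0 s) (at s)"
      using 1 by (auto intro!: derivative_eq_intros)
    then show ?thesis
      by (rule has_field_derivative_transform_within_open[of _ _ _ "{0<..}"]) (use 1 in auto)
  next
    case 2
    have "((\<lambda>s::real. 0) has_real_derivative 2 * max 0 s) (at s)"
      using 2 by auto
    then show ?thesis
      by (rule has_field_derivative_transform_within_open[of _ _ _ "{..<0}"]) (use 2 in auto)
  next
    case 3
    have "(max 0 h)\<^sup>2 / h = max 0 h" for h :: real
      by (auto simp: max_def power2_eq_square)
    moreover have "((\<lambda>h::real. max 0 h) \<longlongrightarrow> max 0 0) (at 0)"
      by (intro tendsto_intros)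
    ultimately show ?thesis using 3 by (simp add: DERIV_def)
  qed
qed

text \<open>A \<open>C\<^sup>1\<close> cutoff equal to 1 for \<open>\<bar>t\<bar> \<le> 1\<close> and to 0 for \<open>t\<^sup>2 \<ge> 2\<close>.\<close>

definition bump :: "real \<Rightarrow> real" where
  "bump t = (max 0 (1 - (max 0 (t\<^sup>2 - 1))\<^sup>2))\<^sup>2"

definition bump_deriv :: "real \<Rightarrow> real" where
  "bump_deriv t = - 8 * t * max 0 (t\<^sup>2 - 1) * max 0 (1 - (max 0 (t\<^sup>2 - 1))\<^sup>2)"

lemma DERIV_bump: "(bump has_real_derivative bump_deriv t) (at t)"
proof -
  have "((\<lambda>t. (max 0 (t\<^sup>2 - 1))\<^sup>2) has_real_derivative 2 * max 0 (t\<^sup>2 - 1) * (2 * t)) (at t)"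
    by (rule DERIV_chain2[OF DERIV_max_0_power2]) (auto intro!: derivative_eq_intros)
  then have "((\<lambda>t. 1 - (max 0 (t\<^sup>2 - 1))\<^sup>2) has_real_derivative - (2 * max 0 (t\<^sup>2 - 1) * (2 * t))) (at t)"
    by (rule DERIV_cong[OF DERIV_diff[OF DERIV_const]]) simp
  from DERIV_chain2[OF DERIV_max_0_power2 this] show ?thesis
    unfolding bump_def[abs_def] bump_deriv_def by (rule DERIV_cong) simp
qed

lemma continuous_on_bump [continuous_intros]:
  "continuous_on S g \<Longrightarrow> continuous_on S (\<lambda>x. bump (g x))"
  unfolding bump_def by (intro continuous_intros)

lemma continuous_on_bump_deriv [continuous_intros]:
  "continuous_on S g \<Longrightarrow> continuous_on S (\<lambda>x. bump_deriv (g x))"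
  unfolding bump_deriv_def by (intro continuous_intros)

lemma bump_nonneg: "0 \<le> bump t"
  by (simp add: bump_def)

lemma bump_le_1: "bump t \<le> 1"
  by (auto simp: bump_def intro!: power_le_one)

lemma bump_eq_1: "\<bar>t\<bar> \<le> 1 \<Longrightarrow> bump t = 1"
  using abs_square_le_1[of t] by (simp add: bump_def max_def)

lemma bump_deriv_eq_0: "\<bar>t\<bar> \<le> 1 \<Longrightarrow> bump_deriv t = 0"
  using abs_square_le_1[of t] by (simp add: bump_deriv_def max_def)

text \<open>The rational threshold 3/2 lies above the square root of 2, since 9/4 - 1 is at least 1,
  and below 2. The cutoff at scale \<open>R\<close> is thus supported strictly inside the square of
  half side \<open>2 * R\<close>.\<close>

lemma bump_inner_eq_0:
  fixes t :: real
  assumes "3/2 \<le> \<bar>t\<bar>"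
  shows "max 0 (1 - (max 0 (t\<^sup>2 - 1))\<^sup>2) = 0"
proof -
  have "1 \<le> t\<^sup>2 - 1"
    using power_mono[of "3/2" "\<bar>t\<bar>" 2] assms by (simp add: power2_eq_square)
  then have "1 \<le> (max 0 (t\<^sup>2 - 1))\<^sup>2"
    by (intro one_le_power) simp
  then show ?thesis by simp
qed

lemma bump_eq_0: "3/2 \<le> \<bar>t\<bar> \<Longrightarrow> bump t = 0"
  unfolding bump_def by (simp only: bump_inner_eq_0) simp

text \<open>With \<open>a = max 0 (t\<^sup>2 - 1)\<close>, the derivative vanishes for
  \<open>a > 1\<close> and for \<open>\<bar>t\<bar>\<close> at least 3/2. Otherwise its modulus is 8
  times a product of \<open>\<bar>t\<bar>\<close> with two factors in the unit interval, hence at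
  most 8 * 3/2 = 12.\<close>

lemma abs_bump_deriv_le: "\<bar>bump_deriv t\<bar> \<le> 12"
proof (cases "3/2 \<le> \<bar>t\<bar>")
  case True
  then have "bump_deriv t = 0"
    unfolding bump_deriv_def by (simp only: bump_inner_eq_0)
  then show ?thesis by simp
next
  case False
  show ?thesis
  proof (cases "(max 0 (t\<^sup>2 - 1))\<^sup>2 \<le> 1")
    case True
    define a where "a = max 0 (t\<^sup>2 - 1)"
    have a: "0 \<le> a" "a \<le> 1" "a\<^sup>2 \<le> 1"
      using True abs_square_le_1[of a] by (auto simp: a_def)
    have "\<bar>bump_deriv t\<bar> = 8 * (\<bar>t\<bar> * a * (1 - a\<^sup>2))"
      using a unfolding bump_deriv_def a_def[symmetric] by (simp add: abs_mult)
    also have "\<dots> \<le> 8 * (3/2 * 1 * 1)"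
      using False a by (intro mult_left_mono mult_mono) auto
    finally show ?thesis by simp
  qed (simp add: bump_deriv_def max_def)
qed

definition cutoff :: "real \<Rightarrow> real \<times> real \<Rightarrow> real" where
  "cutoff R z = bump (fst z / R) * bump (snd z / R)"

definition cutoff_x :: "real \<Rightarrow> real \<times> real \<Rightarrow> real" where
  "cutoff_x R z = bump_deriv (fst z / R) / R * bump (snd z / R)"

definition cutoff_y :: "real \<Rightarrow> real \<times> real \<Rightarrow> real" where
  "cutoff_y R z = bump (fst z / R) * (bump_deriv (snd z / R) / R)"

lemma C1_partials_cutoff: "R > 0 \<Longrightarrow> C1_partials (cutoff R) (cutoff_x R) (cutoff_y R)"
  unfolding C1_partials_def cutoff_def[abs_def] cutoff_x_def[abs_def] cutoff_y_def[abs_def]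
  by (auto intro!: continuous_intros derivative_eq_intros DERIV_chain2[OF DERIV_bump])

text \<open>The constant 144 is the square of the bound 12 on \<open>bump_deriv\<close>.\<close>

lemma cutoff_bounds:
  assumes "R > 0"
  shows "0 \<le> cutoff R z" "cutoff R z \<le> 1" "(cutoff_x R z)\<^sup>2 \<le> 144 / R\<^sup>2" "(cutoff_y R z)\<^sup>2 \<le> 144 / R\<^sup>2"
proof -
  have d: "(bump_deriv s * bump t)\<^sup>2 \<le> 12\<^sup>2" for s t
  proof (rule power2_le_iff_abs_le[THEN iffD2])
    have "\<bar>bump_deriv s\<bar> * \<bar>bump t\<bar> \<le> 12 * 1"
      using bump_nonneg[of t] bump_le_1[of t] by (intro mult_mono abs_bump_deriv_le) auto
    then show "\<bar>bump_deriv s * bump t\<bar> \<le> 12" by (simp add: abs_mult)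
  qed simp
  show "0 \<le> cutoff R z" "cutoff R z \<le> 1"
    by (simp_all add: cutoff_def bump_nonneg bump_le_1 mult_le_one)
  show "(cutoff_x R z)\<^sup>2 \<le> 144 / R\<^sup>2" "(cutoff_y R z)\<^sup>2 \<le> 144 / R\<^sup>2"
    using d[of "fst z / R" "snd z / R"] d[of "snd z / R" "fst z / R"] assms
    by (simp_all add: cutoff_x_def cutoff_y_def divide_simps power_divide power_mult_distrib mult.commute)
qed

section \<open>Caccioppoli inequality and hole filling\<close>

text \<open>Passing to the supremum \<open>S\<close> of \<open>E\<close> turns the hypothesis into \<open>S \<le> D / e\<close> for every \<open>e\<close>.\<close>

lemma nonpos_of_hole_filling:
  fixes E :: "real \<Rightarrow> real"
  assumes bound: "\<And>R. R > 0 \<Longrightarrow> E R \<le> B"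
    and fill: "\<And>R e. R > 0 \<Longrightarrow> e > 0 \<Longrightarrow> E R \<le> e * (E (2 * R) - E R) + D / e"
    and "R > 0"
  shows "E R \<le> 0"
proof -
  define S where "S = (SUP r\<in>{0<..}. E r)"
  have bdd: "bdd_above (E ` {0<..})"
    by (rule bdd_aboveI2[where M = B]) (use bound in auto)
  have le: "E r \<le> S" if "r > 0" for r
    unfolding S_def using that by (intro cSUP_upper bdd) auto
  have "S \<le> D / e" if e: "e > 0" for e
  proof -
    \<comment> \<open>The hole is filled by moving \<open>e * E r\<close> to the left. After the
      supremum is taken, the terms \<open>e * S\<close> on the two sides cancel.\<close>
    have "E r \<le> (e * S + D / e) / (1 + e)" if "r > 0" for r
    proof -
      have "E r \<le> e * (E (2 * r) - E r) + D / e" using fill that e by blast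
      also have "\<dots> \<le> e * (S - E r) + D / e"
        using le[of "2 * r"] that e by (intro add_right_mono mult_left_mono) auto
      finally have "E r * (1 + e) \<le> e * S + D / e" by (simp add: algebra_simps)
      then show ?thesis using e by (simp add: pos_le_divide_eq)
    qed
    then have "S \<le> (e * S + D / e) / (1 + e)"
      by (subst S_def, intro cSUP_least) auto
    then have "S * (1 + e) \<le> e * S + D / e" using e by (simp add: pos_le_divide_eq)
    then show ?thesis by (simp add: algebra_simps)
  qed
  \<comment> \<open>The weight \<open>e\<close> is sent to infinity, not to 0.\<close>
  moreover have "((\<lambda>e. D / e) \<longlongrightarrow> 0) at_top"
    by (intro tendsto_divide_0[OF tendsto_const] filterlim_at_top_imp_at_infinity filterlim_ident)
  ultimately have "S \<le> 0"
    by (intro tendsto_lowerbound) (auto intro: eventually_mono[OF eventually_gt_at_top[of 0]])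
  then show ?thesis using le[of R] assms(3) by simp
qed

text \<open>Young's inequality, obtained by expanding the square of
  \<open>e * a - b\<close>.\<close>

lemma two_mult_le_weighted_squares:
  fixes a b e :: real
  assumes "e > 0"
  shows "2 * a * b \<le> e * a\<^sup>2 + b\<^sup>2 / e"
proof -
  have "0 \<le> (e * a - b)\<^sup>2 / e" using assms by simp
  also have "\<dots> = e * a\<^sup>2 + b\<^sup>2 / e - 2 * a * b"
    using assms by (simp add: power2_eq_square field_simps)
  finally show ?thesis by simp
qed

lemma content_centered_square: "R \<ge> 0 \<Longrightarrow> measure lborel (cbox (-R, -R) (R, R :: real)) = 4 * R\<^sup>2"
  by (simp add: content_Pair power2_eq_square)

text \<open>In the plane, the area of a square of size \<open>R\<close> compensates the squared cutoff gradient
  of order \<open>R\<^sup>-\<^sup>2\<close>, so the error terms below stay bounded in \<open>R\<close>.\<close>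

lemma bounded_solution_partials_eq_0:
  assumes v: "C1_partials v vx vy" and w: "C1_partials w wx wy"
    and vy: "\<And>z. vy z = - wx z" and vx: "\<And>z. vx z = \<theta> z * wy z"
    and \<theta>: "\<And>z. 0 < \<theta> z" "\<And>z. \<theta> z \<le> K" and C: "\<And>z. \<bar>w z\<bar> \<le> C"
  shows "wx z = 0" "wy z = 0"
proof -
  \<comment> \<open>The energy density is written as the Jacobian of \<open>v\<close> and
    \<open>w\<close>, which makes it continuous although nothing is assumed on the continuity of
    \<open>\<theta>\<close>. The two equations turn it into a weighted sum of squares.\<close>
  define e where "e z = vx z * wy z - vy z * wx z" for z
  define Q :: "real \<Rightarrow> (real \<times> real) set" where "Q R = cbox (-R, -R) (R, R)" for R
  define E where "E R = integral (Q R) e" for R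
  define g where "g R z = 2 * cutoff R z * w z * (cutoff_x R z * vy z - cutoff_y R z * vx z)" for R z
  define D where "D = 144 * C\<^sup>2 * (1 + K)"
  have K: "0 < K" using \<theta>[of undefined] by linarith
  have e: "e z = (wx z)\<^sup>2 + \<theta> z * (wy z)\<^sup>2" for z
    by (simp add: e_def vy vx power2_eq_square)
  have e_nonneg: "0 \<le> e z" for z
    using \<theta>(1)[of z] by (simp add: e)
  note cont = C1_partialsD(1-3)[OF v] C1_partialsD(1-3)[OF w] C1_partialsD(1-3)[OF C1_partials_cutoff]
  have cont_e: "continuous_on UNIV e"
    unfolding e_def[abs_def] by (intro continuous_intros cont)
  have cont_g: "continuous_on UNIV (g R)" if "R > 0" for R
    unfolding g_def[abs_def] by (intro continuous_intros cont that)
  have cont_c: "continuous_on UNIV (\<lambda>z. (cutoff R z)\<^sup>2 * e z)" if "R > 0" for R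
    by (intro continuous_intros cont cont_e that)
  have int: "F integrable_on Q R" if "continuous_on UNIV F" for F :: "real \<times> real \<Rightarrow> real" and R
    unfolding Q_def using that continuous_on_subset integrable_continuous by blast
  have content_Q: "measure lborel (Q R) = 4 * R\<^sup>2" if "R > 0" for R
    unfolding Q_def using that by (simp add: content_centered_square)
  have Q_subset: "Q R \<subseteq> Q (2 * R)" if "R > 0" for R
    using that by (auto simp: Q_def cbox_Pair_eq)
  have cutoff_Q: "cutoff R z = 1" "cutoff_x R z = 0" "cutoff_y R z = 0" if "R > 0" "z \<in> Q R" for R z
  proof -
    have "\<bar>fst z / R\<bar> \<le> 1" "\<bar>snd z / R\<bar> \<le> 1"
      using that by (cases z; auto simp: Q_def cbox_Pair_eq abs_le_iff divide_simps)+
    then show "cutoff R z = 1" "cutoff_x R z = 0" "cutoff_y R z = 0"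
      by (simp_all add: cutoff_def cutoff_x_def cutoff_y_def bump_eq_1 bump_deriv_eq_0 del: abs_divide)
  qed

  \<comment> \<open>Apply \<open>integral_partials_swap\<close> to
    \<open>p = \<eta>\<^sup>2 w\<close> with \<open>\<eta>\<close> the cutoff. The derivatives of
    \<open>w\<close> give the energy and those of \<open>\<eta>\<^sup>2\<close> give
    \<open>g\<close>.\<close>
  have energy: "integral (Q (2 * R)) (\<lambda>z. (cutoff R z)\<^sup>2 * e z) = integral (Q (2 * R)) (g R)"
    if R: "R > 0" for R
  proof -
    define px where "px z = (cutoff_x R z * cutoff R z + cutoff R z * cutoff_x R z) * w z
      + cutoff R z * cutoff R z * wx z" for z
    define py where "py z = (cutoff_y R z * cutoff R z + cutoff R z * cutoff_y R z) * w z
      + cutoff R z * cutoff R z * wy z" for z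
    have p: "C1_partials (\<lambda>z. cutoff R z * cutoff R z * w z) px py"
      unfolding px_def[abs_def] py_def[abs_def] by (intro C1_partials_mult C1_partials_cutoff R w)
    have "integral (Q (2 * R)) (\<lambda>z. px z * vy z) = integral (Q (2 * R)) (\<lambda>z. py z * vx z)"
      unfolding Q_def
    proof (rule integral_partials_swap[OF p v, where m = "3/2 * R"])
      fix x y assume "\<not> (\<bar>x\<bar> \<le> 3/2 * R \<and> \<bar>y\<bar> \<le> 3/2 * R)"
      then have "3/2 \<le> \<bar>x / R\<bar> \<or> 3/2 \<le> \<bar>y / R\<bar>"
        using R by (auto simp: divide_simps)
      then show "cutoff R (x, y) * cutoff R (x, y) * w (x, y) = 0"
        by (auto simp: cutoff_def bump_eq_0 simp del: abs_divide)
    qed (use R in auto)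
    then have "integral (Q (2 * R)) (\<lambda>z. px z * vy z - py z * vx z) = 0"
      using C1_partialsD[OF p] by (subst integral_diff) (auto intro!: int continuous_intros cont)
    moreover have "px z * vy z - py z * vx z = g R z - (cutoff R z)\<^sup>2 * e z" for z
      by (simp add: px_def py_def g_def e_def power2_eq_square algebra_simps)
    ultimately show ?thesis
      by (simp add: integral_diff int cont_g cont_c R)
  qed

  \<comment> \<open>Young's inequality is used separately in the two directions, with
    \<open>\<theta>\<close> kept as a factor of the second. The bound \<open>K\<close> then enters
    only in the term without derivatives of \<open>w\<close>, and the remaining squares form the
    energy density.\<close>
  have g_le: "g R z \<le> \<epsilon> * ((cutoff R z)\<^sup>2 * e z) + D / R\<^sup>2 / \<epsilon>" if R: "R > 0" and \<epsilon>: "\<epsilon> > 0" for R \<epsilon> z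
  proof -
    let ?c = "cutoff R z" and ?cx = "cutoff_x R z" and ?cy = "cutoff_y R z"
    have w2: "(w z)\<^sup>2 \<le> C\<^sup>2" using C[of z] by (metis abs_ge_zero power2_abs power_mono)
    have "(w z)\<^sup>2 * ?cx\<^sup>2 + \<theta> z * ((w z)\<^sup>2 * ?cy\<^sup>2) \<le> C\<^sup>2 * (144 / R\<^sup>2) + K * (C\<^sup>2 * (144 / R\<^sup>2))"
      using \<theta>[of z] K cutoff_bounds[OF R, of z] by (intro add_mono mult_mono w2) auto
    also have "\<dots> = D / R\<^sup>2" by (simp add: D_def algebra_simps add_divide_distrib)
    finally have D: "((w z)\<^sup>2 * ?cx\<^sup>2 + \<theta> z * ((w z)\<^sup>2 * ?cy\<^sup>2)) / \<epsilon> \<le> D / R\<^sup>2 / \<epsilon>"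
      using \<epsilon> by (intro divide_right_mono) auto
    have "g R z = 2 * (?c * wx z) * (- w z * ?cx) + \<theta> z * (2 * (?c * wy z) * (- w z * ?cy))"
      by (simp add: g_def vx vy algebra_simps)
    also have "\<dots> \<le> (\<epsilon> * (?c * wx z)\<^sup>2 + (- w z * ?cx)\<^sup>2 / \<epsilon>)
        + \<theta> z * (\<epsilon> * (?c * wy z)\<^sup>2 + (- w z * ?cy)\<^sup>2 / \<epsilon>)"
      using \<theta>(1)[of z] by (intro add_mono mult_left_mono two_mult_le_weighted_squares \<epsilon>) auto
    also have "\<dots> = \<epsilon> * (?c\<^sup>2 * e z) + ((w z)\<^sup>2 * ?cx\<^sup>2 + \<theta> z * ((w z)\<^sup>2 * ?cy\<^sup>2)) / \<epsilon>"
      by (simp add: e power_mult_distrib algebra_simps add_divide_distrib)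
    finally show ?thesis using D by linarith
  qed

  have E_le: "E R \<le> integral (Q (2 * R)) (\<lambda>z. (cutoff R z)\<^sup>2 * e z)" if R: "R > 0" for R
  proof -
    have "E R = integral (Q R) (\<lambda>z. (cutoff R z)\<^sup>2 * e z)"
      unfolding E_def by (rule integral_cong) (simp add: cutoff_Q R)
    also have "\<dots> \<le> integral (Q (2 * R)) (\<lambda>z. (cutoff R z)\<^sup>2 * e z)"
      by (intro integral_subset_le int cont_c Q_subset R) (auto simp: e_nonneg)
    finally show ?thesis .
  qed

  \<comment> \<open>Weight 1/2 lets half of the weighted energy be absorbed on the left. The square
    has area 16 times \<open>R\<^sup>2\<close>, so the error is 32 * D, and absorption doubles
    it.\<close>
  have bound: "E R \<le> 64 * D" if R: "R > 0" for R
  proof -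
    let ?I = "integral (Q (2 * R)) (\<lambda>z. (cutoff R z)\<^sup>2 * e z)"
    have "?I \<le> integral (Q (2 * R)) (\<lambda>z. 1/2 * ((cutoff R z)\<^sup>2 * e z) + D / R\<^sup>2 / (1/2))"
      unfolding energy[OF R]
      by (intro integral_le int cont_g cont_c R continuous_intros g_le) auto
    also have "\<dots> = 1/2 * ?I + 16 * R\<^sup>2 * (D / R\<^sup>2 / (1/2))"
      using R content_Q[of "2 * R"] int[OF cont_c[OF R], of "2 * R"]
      by (subst integral_add)
        (auto intro!: int cont_c continuous_intros simp: integral_mult_right power_mult_distrib Q_def)
    also have "16 * R\<^sup>2 * (D / R\<^sup>2 / (1/2)) = 32 * D" using R by simp
    finally show ?thesis using E_le[OF R] by simp
  qed

  \<comment> \<open>The cutoff is constant on \<open>Q R\<close>, so \<open>g\<close> lives on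
    \<open>Q (2 * R) - Q R\<close>. The area of this ring, 16 - 4 = 12 times
    \<open>R\<^sup>2\<close>, gives the constant 12.\<close>
  have fill: "E R \<le> \<epsilon> * (E (2 * R) - E R) + 12 * D / \<epsilon>" if R: "R > 0" and \<epsilon>: "\<epsilon> > 0" for R \<epsilon>
  proof -
    let ?h = "\<lambda>z. \<epsilon> * e z + D / R\<^sup>2 / \<epsilon>"
    have neg: "negligible (Q R - Q (2 * R))" using Q_subset[OF R] by simp
    have diff: "F integrable_on Q (2 * R) - Q R"
      "integral (Q (2 * R) - Q R) F = integral (Q (2 * R)) F - integral (Q R) F"
      if "continuous_on UNIV F" for F :: "real \<times> real \<Rightarrow> real"
      using int[OF that] neg by (auto intro: integral_setdiff integrable_setdiff)
    have cont_h: "continuous_on UNIV ?h" by (intro continuous_intros cont_e)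
    have int_h: "integral (Q r) ?h = \<epsilon> * E r + 4 * r\<^sup>2 * (D / R\<^sup>2 / \<epsilon>)" if "r > 0" for r
      using content_Q[OF that] int[of "\<lambda>z. \<epsilon> * e z" r] continuous_on_mult[OF continuous_on_const cont_e]
      by (subst integral_add) (auto intro!: int cont_e continuous_intros simp: E_def Q_def)
    have g0: "integral (Q R) (g R) = 0"
      by (rule integral_unique, rule has_integral_is_0) (simp add: g_def cutoff_Q R)
    have "E R \<le> integral (Q (2 * R)) (g R)" using E_le[OF R] energy[OF R] by simp
    also have "\<dots> = integral (Q (2 * R) - Q R) (g R)"
      using g0 by (simp add: diff cont_g R)
    also have "\<dots> \<le> integral (Q (2 * R) - Q R) ?h"
    proof (intro integral_le diff cont_g cont_h R)
      fix z
      have "(cutoff R z)\<^sup>2 * e z \<le> 1 * e z"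
        using cutoff_bounds[OF R, of z] by (intro mult_right_mono e_nonneg power_le_one) auto
      then have "\<epsilon> * ((cutoff R z)\<^sup>2 * e z) \<le> \<epsilon> * e z" using \<epsilon> by simp
      then show "g R z \<le> ?h z" using g_le[OF R \<epsilon>, of z] by linarith
    qed
    also have "\<dots> = \<epsilon> * (E (2 * R) - E R) + 12 * D / \<epsilon>"
      unfolding diff(2)[OF cont_h] int_h[OF R] int_h[OF mult_pos_pos[OF zero_less_numeral R]]
      using R by (simp add: field_simps power_mult_distrib)
    finally show ?thesis .
  qed

  have "e z = 0"
  proof -
    \<comment> \<open>The summand 1 keeps the square nondegenerate when \<open>z\<close> is the
      origin. On it a continuous nonnegative density with integral 0 vanishes at every point, in
      particular at \<open>z\<close>.\<close>
    define R where "R = norm z + 1"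
    have "\<bar>fst z\<bar> \<le> norm z" "\<bar>snd z\<bar> \<le> norm z"
      using norm_fst_le[of "fst z" "snd z"] norm_snd_le[of "snd z" "fst z"] by simp_all
    then have R: "R > 0" "z \<in> cbox (-R, -R) (R, R)"
      by (auto simp: R_def Q_def mem_box cbox_Pair_eq mem_Times_iff)
    have "E R \<le> 0" by (rule nonpos_of_hole_filling[of E "64 * D" "12 * D", OF bound fill R(1)])
    moreover have "0 \<le> E R" unfolding E_def by (intro integral_nonneg int cont_e e_nonneg)
    ultimately have "(e has_integral 0) (cbox (-R, -R) (R, R))"
      using int[OF cont_e, of R] by (simp add: E_def Q_def has_integral_iff)
    moreover have "(0, 0) \<in> box (-R, -R) (R, R)"
      using R(1) by (auto simp: mem_box Basis_prod_def)
    ultimately show ?thesis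
      using has_integral_0_cbox_imp_0[OF continuous_on_subset[OF cont_e] e_nonneg _ _ R(2)] by blast
  qed
  then show "wx z = 0" "wy z = 0"
    using \<theta>(1)[of z] by (simp_all add: e add_nonneg_eq_0_iff)
qed

section \<open>Symmetry of second derivatives, composition and constancy\<close>

text \<open>Write an increment of \<open>p\<close> in the second variable as an integral of
  \<open>py\<close> and differentiate under the integral in the first variable. This exhibits an
  increment of \<open>px\<close> as an integral of \<open>pyx\<close>; differentiating in the upper
  limit gives the equality.\<close>

lemma C1_partials_mixed_eq:
  assumes p: "C1_partials p px py" and px: "C1_partials px pxx pxy" and py: "C1_partials py pyx pyy"
  shows "pxy = pyx"
proof
  fix z :: "real \<times> real"
  obtain x y where z: "z = (x, y)" by force
  define a where "a = y - 1"
  define b where "b = y + 1"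
  have ftc: "integral {a..s} (\<lambda>t. pyx (x, t)) = px (x, s) - px (x, a)" if "a \<le> s" for s
  proof -
    have "integral {a..s} (\<lambda>t. py (r, t)) = p (r, s) - p (r, a)" for r
      using C1_partialsD(5)[OF p] that
      by (intro integral_unique fundamental_theorem_of_calculus)
        (auto simp: has_real_derivative_iff_has_vector_derivative[symmetric]
          intro: has_field_derivative_at_within)
    moreover have "((\<lambda>r. p (r, s) - p (r, a)) has_real_derivative px (x, s) - px (x, a)) (at x)"
      by (intro derivative_intros C1_partialsD(4)[OF p])
    ultimately have 1: "((\<lambda>r. integral (cbox a s) (\<lambda>t. py (r, t))) has_real_derivative px (x, s) - px (x, a)) (at x)"
      by simp
    have "((\<lambda>r. integral (cbox a s) (\<lambda>t. py (r, t))) has_real_derivative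
        integral (cbox a s) (\<lambda>t. pyx (x, t))) (at x within UNIV)"
    proof (rule leibniz_rule_field_derivative[where fx = "\<lambda>r t. pyx (r, t)"])
      show "(\<lambda>t. py (r, t)) integrable_on cbox a s" for r
        by (intro integrable_continuous continuous_on_compose2[OF C1_partialsD(1)[OF py]] continuous_intros) auto
      show "continuous_on (UNIV \<times> cbox a s) (\<lambda>(r, t). pyx (r, t))"
        using C1_partialsD(2)[OF py] continuous_on_subset by auto
    qed (use C1_partialsD(4)[OF py] in auto)
    with 1 show ?thesis using DERIV_unique by fastforce
  qed
  have "((\<lambda>s. integral {a..s} (\<lambda>t. pyx (x, t))) has_real_derivative pyx (x, y)) (at y within {a..b})"
    by (intro integral_has_real_derivative continuous_on_compose2[OF C1_partialsD(2)[OF py]] continuous_intros)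
      (auto simp: a_def b_def)
  then have "((\<lambda>s. integral {a..s} (\<lambda>t. pyx (x, t))) has_real_derivative pyx (x, y)) (at y)"
    using at_within_interior[of y "{a..b}"] by (simp add: a_def b_def)
  moreover have "a < y" by (simp add: a_def)
  ultimately have "((\<lambda>s. px (x, s) - px (x, a)) has_real_derivative pyx (x, y)) (at y)"
    by (elim has_field_derivative_transform_within_open[of _ _ _ "{a<..}"]) (auto simp: ftc)
  moreover have "((\<lambda>s. px (x, s) - px (x, a)) has_real_derivative pxy (x, y) - 0) (at y)"
    by (intro derivative_intros C1_partialsD(5)[OF px])
  ultimately show "pxy z = pyx z"
    unfolding z using DERIV_unique by fastforce
qed

lemma C1_partials_compose:
  assumes "C1_partials p px py" "continuous_on UNIV h" "continuous_on UNIV h'"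
    and "\<And>t. (h has_real_derivative h' t) (at t)"
  shows "C1_partials (\<lambda>z. h (p z)) (\<lambda>z. h' (p z) * px z) (\<lambda>z. h' (p z) * py z)"
  using assms unfolding C1_partials_def
  by (auto intro!: continuous_intros continuous_on_compose2[of UNIV h] continuous_on_compose2[of UNIV h']
      DERIV_chain2[where f = h])

lemma C1_partials_eq_0_imp_const:
  assumes "C1_partials p (\<lambda>_. 0) (\<lambda>_. 0)"
  shows "p z = p (0, 0)"
proof -
  obtain x y where z: "z = (x, y)" by force
  have "p (x, y) = p (0, y)"
    by (rule DERIV_isconst_all[of "\<lambda>t. p (t, y)"]) (use C1_partialsD(4)[OF assms] in auto)
  also have "\<dots> = p (0, 0)"
    by (rule DERIV_isconst_all[of "\<lambda>t. p (0, t)"]) (use C1_partialsD(5)[OF assms] in auto)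
  finally show ?thesis by (simp add: z)
qed

section \<open>Passage from \<open>real^2\<close> to the plane of pairs, and the reduction to a
  bounded solution\<close>

text \<open>The axes are parameters so that exchanging the two coordinates amounts to exchanging
  \<open>i\<close> and \<open>j\<close>.\<close>

definition plane_point :: "'n::finite \<Rightarrow> 'n \<Rightarrow> real \<times> real \<Rightarrow> real^'n" where
  "plane_point i j z = fst z *\<^sub>R axis i 1 + snd z *\<^sub>R axis j 1"

lemma continuous_on_plane_point [continuous_intros]: "continuous_on S (plane_point i j)"
  unfolding plane_point_def[abs_def] by (intro continuous_intros)

lemma plane_point_surj:
  fixes i j :: 2
  assumes "i \<noteq> j"
  shows "x = plane_point i j (x $ i, x $ j)"
  using assms exhaust_2[of i] exhaust_2[of j]
  by (auto simp: plane_point_def vec_eq_iff forall_2 axis_def)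

lemma C1_partials_plane:
  assumes "continuous_on UNIV g" "\<And>k x. partially_differentiable k g x"
    and "\<And>k. continuous_on UNIV (partial_deriv k g)"
  shows "C1_partials (\<lambda>z. g (plane_point i j z))
    (\<lambda>z. partial_deriv i g (plane_point i j z)) (\<lambda>z. partial_deriv j g (plane_point i j z))"
proof -
  \<comment> \<open>\<open>partial_deriv\<close> is a derivative at parameter 0, so the base point
    is moved along the axis to reach parameter \<open>s\<close>.\<close>
  have d: "((\<lambda>t. g (x + t *\<^sub>R axis k 1)) has_real_derivative partial_deriv k g (x + s *\<^sub>R axis k 1)) (at s)"
    for k x s
  proof -
    have "((\<lambda>t. g (x + s *\<^sub>R axis k 1 + t *\<^sub>R axis k 1)) has_real_derivative
        partial_deriv k g (x + s *\<^sub>R axis k 1)) (at 0)"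
      using assms(2) unfolding partially_differentiable_def partial_deriv_def
      by (simp add: DERIV_deriv_iff_field_differentiable)
    then have "((\<lambda>t. g (x + (t + s) *\<^sub>R axis k 1)) has_real_derivative
        partial_deriv k g (x + s *\<^sub>R axis k 1)) (at 0)"
      by (simp add: algebra_simps)
    then show ?thesis
      using DERIV_shift[of "\<lambda>t. g (x + t *\<^sub>R axis k 1)" _ 0 s] by simp
  qed
  have "((\<lambda>t. g (plane_point i j (t, b))) has_real_derivative partial_deriv i g (plane_point i j (a, b))) (at a)" for a b
    using d[of "b *\<^sub>R axis j 1" i a] by (simp add: plane_point_def add.commute)
  moreover have "((\<lambda>t. g (plane_point i j (a, t))) has_real_derivative partial_deriv j g (plane_point i j (a, b))) (at b)" for a b
    using d[of "a *\<^sub>R axis i 1" j b] by (simp add: plane_point_def)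
  ultimately show ?thesis
    unfolding C1_partials_def
    by (auto intro!: continuous_on_compose2[OF assms(1)] continuous_on_compose2[OF assms(3)] continuous_intros)
qed

text \<open>The set where \<open>\<bar>g\<bar>\<close> exceeds an essential bound is open and null,
  hence empty, so an almost everywhere bound holds everywhere.\<close>

lemma L_infinity_continuous_bounded:
  fixes g :: "'a::euclidean_space \<Rightarrow> real"
  assumes "L_infinity g" "continuous_on UNIV g"
  obtains C where "\<And>x. \<bar>g x\<bar> \<le> C"
proof -
  obtain C where C: "AE x in lebesgue. \<bar>g x\<bar> \<le> C"
    using assms(1) by (auto simp: L_infinity_def)
  have op: "open {x. C < \<bar>g x\<bar>}"
    by (intro open_Collect_less continuous_intros assms(2))
  have "{x. C < \<bar>g x\<bar>} \<in> null_sets lebesgue"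
    using C op by (subst AE_iff_null_sets) (auto simp: not_less intro: borel_open)
  then have "{x. C < \<bar>g x\<bar>} = {}"
    using open_not_negligible[OF op] negligible_iff_null_sets by blast
  then show thesis by (intro that[of C]) (auto simp: not_less)
qed

text \<open>The indices and the two functions are kept general so that bounded
  \<open>\<Theta>\<close> and bounded \<open>1 / \<Theta>\<close> are both instances.\<close>

lemma second_partials_eq_0:
  fixes u :: "real^2 \<Rightarrow> real" and i j :: 2
  assumes f: "C_k_real 2 f" "\<And>t. deriv (deriv f) t > 0" "L_infinity (deriv f)"
    and g: "C_k_real 2 g" "\<And>t. deriv (deriv g) t > 0"
    and u: "C_k 2 u" and ij: "i \<noteq> j"
    and eq: "\<And>x. deriv (deriv f) (partial_deriv i u x) * partial_deriv i (partial_deriv i u) x +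
      deriv (deriv g) (partial_deriv j u x) * partial_deriv j (partial_deriv j u) x = 0"
    and K: "L_infinity (\<lambda>x. deriv (deriv g) (partial_deriv j u x) / deriv (deriv f) (partial_deriv i u x))"
  shows "partial_deriv k (partial_deriv l u) x = 0"
proof -
  let ?P = "plane_point i j"
  have u': "continuous_on UNIV u" "\<And>k x. partially_differentiable k u x"
    "\<And>k. continuous_on UNIV (partial_deriv k u)"
    "\<And>k l x. partially_differentiable k (partial_deriv l u) x"
    "\<And>k l. continuous_on UNIV (partial_deriv k (partial_deriv l u))"
    using u by (simp_all add: numeral_2_eq_2)
  have h: "continuous_on UNIV (deriv h)" "continuous_on UNIV (deriv (deriv h))"
    "(deriv h has_real_derivative deriv (deriv h) t) (at t)" if "C_k_real 2 h" for h t
    using that by (simp_all add: numeral_2_eq_2 DERIV_deriv_iff_field_differentiable)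
  note D = C1_partials_plane[OF u'(3) u'(4) u'(5), of _ i j]
  have mixed: "partial_deriv j (partial_deriv i u) (?P z) = partial_deriv i (partial_deriv j u) (?P z)" for z
    using C1_partials_mixed_eq[OF C1_partials_plane[OF u'(1-3)] D D] by (rule fun_cong)
  \<comment> \<open>Here \<open>w\<close> is \<open>deriv f\<close> of the \<open>i\<close>-th
    partial derivative of \<open>u\<close> and \<open>v\<close> is \<open>deriv g\<close> of the
    \<open>j\<close>-th; the bound on \<open>w\<close> comes from that on
    \<open>deriv f\<close>.\<close>
  note w = C1_partials_compose[OF D h[OF f(1)], of i]
  note v = C1_partials_compose[OF D h[OF g(1)], of j]
  obtain C where C: "\<And>t. \<bar>deriv f t\<bar> \<le> C"
    using L_infinity_continuous_bounded[OF f(3)] h[OF f(1)] by blast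
  have "continuous_on UNIV (\<lambda>x. deriv (deriv g) (partial_deriv j u x) / deriv (deriv f) (partial_deriv i u x))"
    using f(2)
    by (intro continuous_intros continuous_on_compose2[OF h(2)[OF f(1)]] continuous_on_compose2[OF h(2)[OF g(1)]] u')
      (auto simp: less_imp_neq[THEN not_sym])
  then obtain L where L: "\<And>x. \<bar>deriv (deriv g) (partial_deriv j u x) / deriv (deriv f) (partial_deriv i u x)\<bar> \<le> L"
    using L_infinity_continuous_bounded[OF K] by blast
  let ?\<theta> = "\<lambda>z. deriv (deriv g) (partial_deriv j u (?P z)) / deriv (deriv f) (partial_deriv i u (?P z))"
  have vy: "deriv (deriv g) (partial_deriv j u (?P z)) * partial_deriv j (partial_deriv j u) (?P z) =
    - (deriv (deriv f) (partial_deriv i u (?P z)) * partial_deriv i (partial_deriv i u) (?P z))" for z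
    using eq[of "?P z"] by linarith
  have f2: "deriv (deriv f) t \<noteq> 0" and g2: "deriv (deriv g) t \<noteq> 0" for t
    using f(2)[of t] g(2)[of t] by auto
  have vx: "deriv (deriv g) (partial_deriv j u (?P z)) * partial_deriv i (partial_deriv j u) (?P z) =
    ?\<theta> z * (deriv (deriv f) (partial_deriv i u (?P z)) * partial_deriv j (partial_deriv i u) (?P z))" for z
    using f2 by (simp add: mixed)
  have \<theta>: "0 < ?\<theta> z" "?\<theta> z \<le> L" for z
    using f(2) g(2) abs_le_D1[OF L] by auto
  have "deriv (deriv f) (partial_deriv i u (?P z)) * partial_deriv i (partial_deriv i u) (?P z) = 0"
    "deriv (deriv f) (partial_deriv i u (?P z)) * partial_deriv j (partial_deriv i u) (?P z) = 0" for z
    using bounded_solution_partials_eq_0[where \<theta> = ?\<theta>, OF v w vy vx \<theta> C] by blast+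
  \<comment> \<open>Positivity of the second derivatives allows division: the vanishing gradient of
    \<open>w\<close> kills two entries of the Hessian, the equation kills the \<open>jj\<close>
    entry and symmetry the last one.\<close>
  then have "partial_deriv i (partial_deriv i u) (?P z) = 0" "partial_deriv j (partial_deriv i u) (?P z) = 0"
    "partial_deriv i (partial_deriv j u) (?P z) = 0" "partial_deriv j (partial_deriv j u) (?P z) = 0" for z
    using vy[of z] mixed[of z] f2 g2 by auto
  moreover have "k = i \<or> k = j" "l = i \<or> l = j"
    using ij exhaust_2[of i] exhaust_2[of j] exhaust_2[of k] exhaust_2[of l] by auto
  ultimately show ?thesis
    using plane_point_surj[OF ij, of x] by metis
qed

text \<open>The first partial derivatives are constants; subtracting the linear function with these
  coefficients leaves a function with zero gradient, which is constant.\<close>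

lemma affine_if_second_partials_eq_0:
  fixes u :: "real^2 \<Rightarrow> real"
  assumes u: "C_k 2 u" and zero: "\<And>k l x. partial_deriv k (partial_deriv l u) x = 0"
  shows "\<exists>a b. \<forall>x. u x = a \<bullet> x + b"
proof -
  let ?P = "plane_point 1 (2 :: 2)"
  have u': "continuous_on UNIV u" "\<And>k x. partially_differentiable k u x"
    "\<And>k. continuous_on UNIV (partial_deriv k u)"
    "\<And>k l x. partially_differentiable k (partial_deriv l u) x"
    "\<And>k l. continuous_on UNIV (partial_deriv k (partial_deriv l u))"
    using u by (simp_all add: numeral_2_eq_2)
  have P: "?P (x $ 1, x $ 2) = x" for x
    using plane_point_surj[of 1 2 x] by simp
  define c where "c k = partial_deriv k u (?P (0, 0))" for k
  have c: "partial_deriv k u (?P z) = c k" for k z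
    using C1_partials_eq_0_imp_const[of "\<lambda>z. partial_deriv k u (?P z)" z]
      C1_partials_plane[OF u'(3) u'(4) u'(5), of k 1 2]
    by (simp add: zero c_def)
  have U: "C1_partials (\<lambda>z. u (?P z)) (\<lambda>z. c 1) (\<lambda>z. c 2)"
    using C1_partials_plane[OF u'(1-3), of 1 2] by (simp add: c)
  have "C1_partials (\<lambda>z. u (?P z) - (c 1 * fst z + c 2 * snd z)) (\<lambda>_. 0) (\<lambda>_. 0)"
    using U unfolding C1_partials_def by (auto intro!: continuous_intros derivative_eq_intros)
  then have *: "u (?P z) - (c 1 * fst z + c 2 * snd z) = u (?P (0, 0))" for z
    using C1_partials_eq_0_imp_const[of "\<lambda>z. u (?P z) - (c 1 * fst z + c 2 * snd z)" z] by simp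
  have "u x = (\<chi> k. c k) \<bullet> x + u (?P (0, 0))" for x
    using *[of "(x $ 1, x $ 2)"] by (simp add: P inner_vec_def sum_2)
  then show ?thesis by blast
qed

theorem theorem1p9:
  fixes f1 f2 :: "real \<Rightarrow> real"
    and f u \<Theta> :: "real^2 \<Rightarrow> real"
  assumes "C_k_real 2 f1" and "C_k_real 2 f2"
    and "\<And>t. deriv (deriv f1) t > 0" and "\<And>t. deriv (deriv f2) t > 0"
    and "L_infinity (deriv f1)" and "L_infinity (deriv f2)"
    and "f = (\<lambda>p. f1 (p $ 1) + f2 (p $ 2))"
    and "C_k 2 u"
    and "\<And>x. divergence (\<lambda>y. gradient f (gradient u y)) x = 0"
    and "\<Theta> = (\<lambda>x. deriv (deriv f2) (partial_deriv 2 u x) / deriv (deriv f1) (partial_deriv 1 u x))"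
    and "L_infinity \<Theta> \<or> L_infinity (\<lambda>x. 1 / \<Theta> x)"
  shows "\<exists>a b. \<forall>x. u x = a \<bullet> x + b"
proof (rule affine_if_second_partials_eq_0[OF assms(8)])
  fix k l x
  have eq: "deriv (deriv f1) (partial_deriv 1 u x) * partial_deriv 1 (partial_deriv 1 u) x +
    deriv (deriv f2) (partial_deriv 2 u x) * partial_deriv 2 (partial_deriv 2 u) x = 0" for x
    using assms(9)[of x] divergence_form_iff[OF assms(1,2,8)] by (simp add: assms(7))
  show "partial_deriv k (partial_deriv l u) x = 0"
    using assms(11)
  proof
    assume "L_infinity \<Theta>"
    then show ?thesis
      using second_partials_eq_0[OF assms(1,3,5) assms(2,4,8) _ eq] by (simp add: assms(10))
  next
    \<comment> \<open>The reciprocal of \<open>\<Theta>\<close> is the same quotient with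
      \<open>f1\<close> and \<open>f2\<close>, and the two coordinates, exchanged.\<close>
    assume "L_infinity (\<lambda>x. 1 / \<Theta> x)"
    then show ?thesis
      using second_partials_eq_0[OF assms(2,4,6) assms(1,3,8), of 2 1] eq
      by (simp add: assms(10) add.commute)
  qed
qed

end
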